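(* Let $(G,H,\widetilde L)$ be a cut and project scheme and let $W\subset H$ be a nonempty compact set which is the closure of its interior and whose boundary has Haar measure $0$. Let $\nu_{\chi_W}=\sum_{x\in L,\ x^\star\in W}\delta_x$. If $\nu_{\chi_W}$ is not crystallographic, then $(\Omega(\nu_{\chi_W}),\alpha)$ is not a factor of $(\mathbb T,\beta)$.
   Context: Cut and project scheme $(G,H,\widetilde L)$: $G,H$ are $\sigma$-compact locally compact (Hausdorff) abelian groups, $\widetilde L\subset G\times H$ is a lattice (discrete cocompact subgroup), the projection $\pi:G\times H\to G$ is injective on $\widetilde L$, and the projection of $\widetilde L$ to $H$ is dense in $H$. Put $L=\pi(\widetilde L)$; for $x\in L$, $x^\star\in H$ is the unique element with $(x,x^\star)\in\widetilde L$. $\mathbb T:=(G\times H)/\widetilde L$ is a compact abelian group with classes $[s,k]$, on which $G$ acts by $\beta_t([s,k])=[s-t,k]$. $\nu_{\chi_W}$ is a translation bounded measure on $G$ (there are $C>0$ and a nonempty open relatively compact $V$ with $|\nu|(t+V)\le C$ for all $t$). $G$ acts on translation bounded measures by $(\alpha_t\nu)(\varphi)=\int\varphi(s+t)\,d\nu(s)$, $\varphi\in C_c(G)$, and $\Omega(\nu)$ is the closure of $\{\alpha_t\nu:t\in G\}$ in the vague topology (pointwise convergence on $C_c(G)$). $\nu$ is crystallographic if $\{t\in G:\alpha_t\nu=\nu\}$ is a cocompact discrete subgroup of $G$. A topological dynamical system $(\Omega,\alpha)$ over $G$ is a factor of $(\mathbb T,\beta)$ if there is a continuous surjection $\psi:\mathbb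 T\to\Omega$ with $\psi(\beta_t\xi)=\alpha_t\psi(\xi)$ for all $t\in G$, $\xi\in\mathbb T$. *)

theory Defs
  imports "HOL-Analysis.Analysis"
begin

section \<open>Subgroups, quotients, lattices\<close>

definition is_subgroup :: "'a::ab_group_add set \<Rightarrow> bool" where
  "is_subgroup S \<longleftrightarrow> 0 \<in> S \<and> (\<forall>x\<in>S. \<forall>y\<in>S. x - y \<in> S)"

definition coset :: "'a::ab_group_add set \<Rightarrow> 'a \<Rightarrow> 'a set" where
  "coset S x = (+) x ` S"

definition quotient_topology :: "'a::{ab_group_add,topological_space} set \<Rightarrow> 'a set topology" where
  "quotient_topology S = topology (\<lambda>U. U \<subseteq> range (coset S) \<and> open (coset S -` U))"

lemma openin_quotient_topology:
  "openin (quotient_topology S) U \<longleftrightarrow> U \<subseteq> range (coset S) \<and> open (coset S -` U)"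
proof -
  have "istopology (\<lambda>U. U \<subseteq> range (coset S) \<and> open (coset S -` U))"
    unfolding istopology_def by (auto simp: vimage_Union)
  then show ?thesis
    unfolding quotient_topology_def by (simp add: topology_inverse')
qed

lemma topspace_quotient_topology: "topspace (quotient_topology S) = range (coset S)"
proof
  show "topspace (quotient_topology S) \<subseteq> range (coset S)"
    unfolding topspace_def using openin_quotient_topology by blast
  have "coset S -` range (coset S) = UNIV"
    by auto
  then have "openin (quotient_topology S) (range (coset S))"
    by (simp add: openin_quotient_topology)
  then show "range (coset S) \<subseteq> topspace (quotient_topology S)"
    by (rule openin_subset)
qed

lemma quotient_map_coset: "quotient_map euclidean (quotient_topology S) (coset S)"
  unfolding quotient_map_def topspace_quotient_topology
  by (auto simp: openin_quotient_topology vimage_def)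

definition is_lattice :: "'a::{ab_group_add,topological_space} set \<Rightarrow> bool" where
  "is_lattice S \<longleftrightarrow> is_subgroup S \<and> discrete S \<and> compact_space (quotient_topology S)"

section \<open>Haar measure\<close>

definition is_haar_measure :: "'a::topological_ab_group_add measure \<Rightarrow> bool" where
  "is_haar_measure m \<longleftrightarrow>
     sets m = sets borel \<and>
     emeasure m UNIV \<noteq> 0 \<and>
     (\<forall>x. \<forall>A\<in>sets borel. emeasure m ((+) x ` A) = emeasure m A) \<and>
     (\<forall>K\<in>sets borel. compact K \<longrightarrow> emeasure m K < \<infinity>) \<and>
     (\<forall>A\<in>sets borel. emeasure m A = (INF U\<in>{U. open U \<and> A \<subseteq> U}. emeasure m U)) \<and>
     (\<forall>U. open U \<longrightarrow>
        emeasure m U = (SUP K\<in>{K. compact K \<and> K \<in> sets borel \<and> K \<subseteq> U}. emeasure m K))"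

section \<open>Complex measures on a locally compact group\<close>

text \<open>
  Complex measures on \<open>G\<close> are taken, via the Riesz--Markov theorem, to be the linear functionals
  on \<open>C\<^sub>c(G)\<close> that are continuous for the inductive limit topology. Functionals are
  extensional, i.e. equal to \<open>undefined\<close> off \<open>C\<^sub>c(G)\<close>, so that HOL equality is equality of measures
  and the vague topology is a subspace of a product topology indexed by \<open>C\<^sub>c(G)\<close>.
\<close>

definition support :: "('g::topological_space \<Rightarrow> complex) \<Rightarrow> 'g set" where
  "support \<phi> = closure {x. \<phi> x \<noteq> 0}"

definition Cc :: "('g::topological_space \<Rightarrow> complex) set" where
  "Cc = {\<phi>. continuous_on UNIV \<phi> \<and> compact (support \<phi>)}"

type_synonym 'g functional = "('g \<Rightarrow> complex) \<Rightarrow> complex"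

definition complex_measures :: "'g::topological_space functional set" where
  "complex_measures = {\<mu> \<in> extensional Cc.
     (\<forall>\<phi>\<in>Cc. \<forall>\<psi>\<in>Cc. \<mu> (\<lambda>x. \<phi> x + \<psi> x) = \<mu> \<phi> + \<mu> \<psi>) \<and>
     (\<forall>c. \<forall>\<phi>\<in>Cc. \<mu> (\<lambda>x. c * \<phi> x) = c * \<mu> \<phi>) \<and>
     (\<forall>K. compact K \<longrightarrow>
        (\<exists>C. \<forall>\<phi>\<in>Cc. support \<phi> \<subseteq> K \<longrightarrow> cmod (\<mu> \<phi>) \<le> C * (SUP x. cmod (\<phi> x))))}"

text \<open>The value \<open>\<bar>\<mu>\<bar>(U)\<close> of the total variation measure; this formula is valid for open \<open>U\<close> only.\<close>

definition variation_open :: "'g::topological_space functional \<Rightarrow> 'g set \<Rightarrow> ennreal" where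
  "variation_open \<mu> U =
     (SUP \<phi>\<in>{\<phi> \<in> Cc. support \<phi> \<subseteq> U \<and> (\<forall>x. cmod (\<phi> x) \<le> 1)}. ennreal (cmod (\<mu> \<phi>)))"

definition translation_bounded_measures :: "'g::topological_ab_group_add functional set" where
  "translation_bounded_measures = {\<mu> \<in> complex_measures.
     \<exists>C>0. \<exists>V. open V \<and> V \<noteq> {} \<and> compact (closure V) \<and>
       (\<forall>t. variation_open \<mu> ((+) t ` V) \<le> ennreal C)}"

definition vague_topology :: "'g::topological_ab_group_add functional topology" where
  "vague_topology =
     subtopology (product_topology (\<lambda>_. euclidean) Cc) translation_bounded_measures"

definition translate :: "'g::topological_ab_group_add \<Rightarrow> 'g functional \<Rightarrow> 'g functional" where
  "translate t \<mu> = (\<lambda>\<phi>\<in>Cc. \<mu> (\<lambda>s. \<phi> (s + t)))"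

definition dirac :: "'g::topological_space \<Rightarrow> 'g functional" where
  "dirac x = (\<lambda>\<phi>\<in>Cc. \<phi> x)"

definition orbit_closure :: "'g::topological_ab_group_add functional \<Rightarrow> 'g functional set" where
  "orbit_closure \<mu> = vague_topology closure_of (range (\<lambda>t. translate t \<mu>))"

definition orbit_closure_topology :: "'g::topological_ab_group_add functional \<Rightarrow> 'g functional topology" where
  "orbit_closure_topology \<mu> = subtopology vague_topology (orbit_closure \<mu>)"

definition crystallographic :: "'g::topological_ab_group_add functional \<Rightarrow> bool" where
  "crystallographic \<mu> \<longleftrightarrow> is_lattice {t. translate t \<mu> = \<mu>}"

section \<open>Cut and project schemes\<close>

definition sigma_compact_space :: "'a topology \<Rightarrow> bool" where
  "sigma_compact_space X \<longleftrightarrow>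
     (\<exists>\<K>. countable \<K> \<and> (\<forall>K\<in>\<K>. compactin X K) \<and> \<Union>\<K> = topspace X)"

definition cut_and_project_scheme ::
  "('g::{topological_ab_group_add,t2_space} \<times> 'h::{topological_ab_group_add,t2_space}) set \<Rightarrow> bool"
where
  "cut_and_project_scheme Lt \<longleftrightarrow>
     sigma_compact_space (euclidean :: 'g topology) \<and>
     locally_compact_space (euclidean :: 'g topology) \<and>
     sigma_compact_space (euclidean :: 'h topology) \<and>
     locally_compact_space (euclidean :: 'h topology) \<and>
     is_lattice Lt \<and> inj_on fst Lt \<and> closure (snd ` Lt) = UNIV"

definition star :: "('g \<times> 'h) set \<Rightarrow> 'g \<Rightarrow> 'h" where
  "star Lt x = (THE k. (x, k) \<in> Lt)"

definition model_set :: "('g \<times> 'h) set \<Rightarrow> 'h set \<Rightarrow> 'g set" where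
  "model_set Lt W = {x \<in> fst ` Lt. star Lt x \<in> W}"

text \<open>For each \<open>\<phi>\<close> in \<open>C\<^sub>c(G)\<close> and compact \<open>W\<close> only finitely many terms of the sum are nonzero.\<close>

definition model_comb :: "('g::topological_ab_group_add \<times> 'h) set \<Rightarrow> 'h set \<Rightarrow> 'g functional" where
  "model_comb Lt W = (\<lambda>\<phi>\<in>Cc. \<Sum>\<^sub>\<infinity>x\<in>model_set Lt W. dirac x \<phi>)"

text \<open>
  The action \<open>[s, k] \<mapsto> [s - t, k]\<close> on the torus \<open>quotient_topology Lt\<close>: points of the torus
  are cosets, and the coset of \<open>(s - t, k)\<close> is the image of the coset of \<open>(s, k)\<close>.
\<close>

definition torus_action ::
  "'g::ab_group_add \<Rightarrow> ('g \<times> 'h::ab_group_add) set \<Rightarrow> ('g \<times> 'h) set" where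
  "torus_action t \<xi> = (\<lambda>(s, k). (s - t, k)) ` \<xi>"

lemma torus_action_coset: "torus_action t (coset Lt (s, k)) = coset Lt (s - t, k)"
  unfolding torus_action_def coset_def by (force simp: image_image algebra_simps)

section \<open>Factors of dynamical systems\<close>

definition is_factor_of ::
  "'y topology \<Rightarrow> ('t \<Rightarrow> 'y \<Rightarrow> 'y) \<Rightarrow> 'x topology \<Rightarrow> ('t \<Rightarrow> 'x \<Rightarrow> 'x) \<Rightarrow> bool" where
  "is_factor_of Y \<alpha> X \<beta> \<longleftrightarrow>
     (\<exists>\<psi>. continuous_map X Y \<psi> \<and> \<psi> ` topspace X = topspace Y \<and>
        (\<forall>t. \<forall>\<xi>\<in>topspace X. \<psi> (\<beta> t \<xi>) = \<alpha> t (\<psi> \<xi>)))"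

end

theory Submission
  imports Defs
begin

text \<open>
  Write \<open>\<nu>\<close> for the model comb, \<open>\<Lambda>\<close> for the model set and let \<open>\<psi>\<close> be a factor map. Since the torus is
  compact, \<open>\<psi>\<close> is uniformly continuous, and translating by \<open>t \<in> L\<close> moves a point \<open>[s, k]\<close> of the torus to
  \<open>[s, k + t\<^sup>\<star>]\<close>. So if \<open>t\<^sup>\<star>\<close> is small, \<open>\<nu>\<close> and its translate by \<open>t\<close> differ by less than \<open>1\<close> on every
  translate of a bump function. As \<open>\<Lambda>\<close> is uniformly discrete, this forces \<open>\<Lambda> - t \<subseteq> \<Lambda>\<close>, and by
  density \<open>W - t\<^sup>\<star> \<subseteq> W\<close>. Hence the stabiliser \<open>S\<close> of \<open>W\<close> in \<open>H\<close> is an open subgroup. Every \<open>t \<in> L\<close>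
  with \<open>t\<^sup>\<star> \<in> S\<close> fixes \<open>\<nu>\<close>, and these \<open>t\<close> already form a cocompact subgroup of \<open>G\<close>, so \<open>\<nu>\<close> is
  crystallographic.
\<close>

section \<open>Topological groups\<close>

text \<open>The lattice lives in \<open>'g \<times> 'h\<close>, and the covering and continuity
  lemmas below are applied to that product as one topological group.\<close>

instance prod :: (topological_monoid_add, topological_monoid_add) topological_monoid_add
proof
  fix a b :: "'a \<times> 'b"
  show "((\<lambda>x. fst x + snd x) \<longlongrightarrow> a + b) (nhds a \<times>\<^sub>F nhds b)"
    unfolding plus_prod_def nhds_prod[symmetric]
    by (intro tendsto_intros) (auto simp: filterlim_def nhds_prod intro!: filtermap_fst_prod_filter filtermap_snd_prod_filter)
qed

instance prod :: (topological_comm_monoid_add, topological_comm_monoid_add) topological_comm_monoid_add ..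

instance prod :: (topological_group_add, topological_group_add) topological_group_add
proof
  show "(uminus \<longlongrightarrow> - a) (nhds a)" for a :: "'a \<times> 'b"
    unfolding uminus_prod_def by (intro tendsto_intros filterlim_ident)
qed

instance prod :: (topological_ab_group_add, topological_ab_group_add) topological_ab_group_add ..

lemma open_translation_vimage:
  fixes U :: "'a::topological_ab_group_add set"
  assumes "open U" shows "open {x. a + x \<in> U}"
proof -
  have "open ((\<lambda>x. a + x) -` U)"
    by (intro open_vimage assms continuous_intros)
  then show ?thesis by (simp add: vimage_def)
qed

text \<open>Continuity of addition at the origin gives a box \<open>A \<times> B\<close>;
  intersecting its sides with \<open>N\<close> and then with the negatives makes \<open>M\<close>
  symmetric, so differences are controlled by sums.\<close>

lemma nhd_zero_add_diff:
  fixes N :: "'a::topological_ab_group_add set"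
  assumes "open N" "0 \<in> N"
  obtains M where "open M" "0 \<in> M" "M \<subseteq> N" "\<And>x. x \<in> M \<Longrightarrow> -x \<in> M"
    "\<And>x y. x \<in> M \<Longrightarrow> y \<in> M \<Longrightarrow> x + y \<in> N" "\<And>x y. x \<in> M \<Longrightarrow> y \<in> M \<Longrightarrow> x - y \<in> N"
proof -
  have "open ((\<lambda>p. fst p + snd p) -` N)"
    by (intro open_vimage assms continuous_intros)
  moreover have "(0,0) \<in> (\<lambda>p. fst p + snd p) -` N"
    using assms by simp
  ultimately obtain A B where AB: "open A" "open B" "0 \<in> A" "0 \<in> B"
      "A \<times> B \<subseteq> (\<lambda>p. fst p + snd p) -` N"
    unfolding open_prod_def by (smt (verit, best) mem_Sigma_iff)
  define M where "M = N \<inter> A \<inter> B \<inter> uminus -` (N \<inter> A \<inter> B)"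
  have "open M"
    unfolding M_def using assms AB
    by (intro open_Int open_vimage continuous_intros) auto
  moreover have *: "x + y \<in> N" if "x \<in> M" "y \<in> M" for x y
    using that AB unfolding M_def by fastforce
  moreover have sym: "-x \<in> M" if "x \<in> M" for x
    using that unfolding M_def by simp
  moreover have "x - y \<in> N" if "x \<in> M" "y \<in> M" for x y
    using *[OF that(1) sym[OF that(2)]] by simp
  ultimately show thesis
    using that[of M] assms AB unfolding M_def by auto
qed

section \<open>Subgroups, cosets and compact quotients\<close>

lemma is_subgroup_closed:
  assumes "is_subgroup S"
  shows "0 \<in> S" "x \<in> S \<Longrightarrow> y \<in> S \<Longrightarrow> x - y \<in> S" "x \<in> S \<Longrightarrow> y \<in> S \<Longrightarrow> x + y \<in> S" "x \<in> S \<Longrightarrow> - x \<in> S"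
proof -
  show *: "0 \<in> S" "x \<in> S \<Longrightarrow> y \<in> S \<Longrightarrow> x - y \<in> S" for x y
    using assms unfolding is_subgroup_def by auto
  show m: "x \<in> S \<Longrightarrow> - x \<in> S" for x
    using *(2)[of 0 x] *(1) by simp
  show "x \<in> S \<Longrightarrow> y \<in> S \<Longrightarrow> x + y \<in> S"
    using *(2)[of x "-y"] m by simp
qed

lemma mem_coset_iff: "y \<in> coset S x \<longleftrightarrow> y - x \<in> S"
  unfolding coset_def by (metis add.commute diff_add_cancel add_diff_cancel_left' image_iff)

lemma coset_eq_iff:
  assumes "is_subgroup S"
  shows "coset S x = coset S y \<longleftrightarrow> x - y \<in> S"
proof
  assume "coset S x = coset S y"
  then show "x - y \<in> S"
    using mem_coset_iff is_subgroup_closed(1)[OF assms] by (metis diff_self)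
next
  assume h: "x - y \<in> S"
  have "z - x \<in> S \<longleftrightarrow> z - y \<in> S" for z
    using is_subgroup_closed(3)[OF assms, of "z - x" "x - y"]
      is_subgroup_closed(2)[OF assms, of "z - y" "x - y"] h by auto
  then show "coset S x = coset S y"
    by (auto simp: mem_coset_iff)
qed

text \<open>The coset map is open, since saturating \<open>U x\<close> by \<open>S\<close> gives a
  union of translates of it. The images of the sets \<open>U x\<close> therefore cover the compact
  quotient openly, and a finite subcover lifts back to the group.\<close>

lemma compact_quotient_finite_cover:
  fixes S :: "'a::topological_ab_group_add set"
  assumes S: "is_subgroup S" and "compact_space (quotient_topology S)"
    and U: "\<And>x. open (U x)" "\<And>x. x \<in> U x"
  obtains F where "finite F" "\<And>y. \<exists>x\<in>F. \<exists>l\<in>S. y + l \<in> U x"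
proof -
  have op: "openin (quotient_topology S) (coset S ` U x)" for x
  proof -
    have "coset S -` (coset S ` U x) = (\<Union>l\<in>S. {y. l + y \<in> U x})"
    proof (intro equalityI subsetI)
      fix y assume "y \<in> coset S -` (coset S ` U x)"
      then obtain z where z: "z \<in> U x" "coset S z = coset S y" by auto
      then have "z - y \<in> S" by (simp add: coset_eq_iff[OF S])
      then show "y \<in> (\<Union>l\<in>S. {y. l + y \<in> U x})"
        using z by (intro UN_I[of "z - y"]) auto
    next
      fix y assume "y \<in> (\<Union>l\<in>S. {y. l + y \<in> U x})"
      then obtain l where l: "l \<in> S" "l + y \<in> U x" by auto
      then have "coset S y = coset S (l + y)"
        by (simp add: coset_eq_iff[OF S] is_subgroup_closed[OF S])
      then show "y \<in> coset S -` (coset S ` U x)"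
        using l by auto
    qed
    moreover have "open (\<Union>l\<in>S. {y. l + y \<in> U x})"
      by (intro open_UN ballI open_translation_vimage U)
    ultimately show ?thesis
      by (auto simp: openin_quotient_topology)
  qed
  have "topspace (quotient_topology S) \<subseteq> \<Union> (range (\<lambda>x. coset S ` U x))"
    using U by (auto simp: topspace_quotient_topology)
  then obtain \<F> where \<F>: "finite \<F>" "\<F> \<subseteq> range (\<lambda>x. coset S ` U x)"
      "topspace (quotient_topology S) \<subseteq> \<Union> \<F>"
    using assms(2) op unfolding compact_space_def compactin_def by (smt (verit, best) imageE)
  obtain F where F: "finite F" "\<F> = (\<lambda>x. coset S ` U x) ` F"
    using finite_subset_image[OF \<F>(1,2)] by auto
  have "\<exists>x\<in>F. \<exists>l\<in>S. y + l \<in> U x" for y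
  proof -
    have "coset S y \<in> topspace (quotient_topology S)"
      by (simp add: topspace_quotient_topology)
    then obtain x z where "x \<in> F" "z \<in> U x" "coset S z = coset S y"
      using \<F>(3) F(2) by auto
    moreover from this have "z - y \<in> S" by (simp add: coset_eq_iff[OF S])
    ultimately show ?thesis by (metis add.commute diff_add_cancel)
  qed
  then show thesis using that F by blast
qed

text \<open>This is the Heine-Cantor argument on the compact quotient, pulled back to the group.
  Each \<open>M x\<close> is chosen so that sums of two of its elements stay controlled; this leaves
  room to add \<open>n\<close> after reaching \<open>y\<close> from a centre \<open>x\<close> modulo
  \<open>S\<close>.\<close>

lemma periodic_continuous_uniformly:
  fixes f :: "'a::topological_ab_group_add \<Rightarrow> 'b::metric_space"
  assumes S: "is_subgroup S" and cpt: "compact_space (quotient_topology S)"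
    and cont: "continuous_on UNIV f" and per: "\<And>x l. l \<in> S \<Longrightarrow> f (x + l) = f x" and "e > 0"
  obtains N where "open N" "0 \<in> N" "\<And>x n. n \<in> N \<Longrightarrow> dist (f (x + n)) (f x) < e"
proof -
  have "\<exists>M. open M \<and> 0 \<in> M \<and> (\<forall>m\<in>M. \<forall>n\<in>M. dist (f (x + m + n)) (f x) < e/2)" for x
  proof -
    have "open ((\<lambda>n. f (x + n)) -` ball (f x) (e/2))"
      by (intro open_vimage continuous_intros continuous_on_compose2[OF cont]) auto
    moreover have "0 \<in> (\<lambda>n. f (x + n)) -` ball (f x) (e/2)"
      using \<open>e > 0\<close> by simp
    ultimately obtain M where "open M" "0 \<in> M"
        "\<And>m n. m \<in> M \<Longrightarrow> n \<in> M \<Longrightarrow> m + n \<in> (\<lambda>n. f (x + n)) -` ball (f x) (e/2)"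
      using nhd_zero_add_diff by metis
    then show ?thesis
      by (intro exI[of _ M]) (auto simp: dist_commute add.assoc)
  qed
  then obtain M where M: "\<And>x. open (M x)" "\<And>x. 0 \<in> M x"
      "\<And>x m n. m \<in> M x \<Longrightarrow> n \<in> M x \<Longrightarrow> dist (f (x + m + n)) (f x) < e/2"
    by metis
  have "open {y. - x + y \<in> M x}" "x \<in> {y. - x + y \<in> M x}" for x
    using open_translation_vimage[OF M(1), of "- x"] M(2) by simp_all
  then obtain F where F: "finite F" "\<And>y. \<exists>x\<in>F. \<exists>l\<in>S. y + l \<in> {y. - x + y \<in> M x}"
    using compact_quotient_finite_cover[OF S cpt, where U="\<lambda>x. {y. - x + y \<in> M x}"] by metis
  have "dist (f (y + n)) (f y) < e" if n: "n \<in> \<Inter> (M ` F)" for y n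
  proof -
    obtain x l where xl: "x \<in> F" "l \<in> S" "- x + (y + l) \<in> M x"
      using F(2)[of y] by blast
    \<comment> \<open>Both \<open>y + n\<close> and \<open>y\<close> are compared with the same
      centre \<open>x\<close>: periodicity removes \<open>l\<close>, and the second summand is
      \<open>n\<close> or \<open>0\<close>.\<close>
    define m where "m = - x + (y + l)"
    have "m \<in> M x" "n \<in> M x" using xl n m_def by auto
    then have "dist (f (x + m + n)) (f x) < e/2" "dist (f (x + m + 0)) (f x) < e/2"
      using M by blast+
    moreover have "x + m + n = y + n + l" "x + m + 0 = y + l"
      unfolding m_def by (simp_all add: algebra_simps)
    ultimately have "dist (f (y + n)) (f x) < e/2" "dist (f y) (f x) < e/2"
      using per[OF xl(2)] by auto
    then show ?thesis using dist_triangle_half_l by blast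
  qed
  moreover have "open (\<Inter> (M ` F))" "0 \<in> \<Inter> (M ` F)"
    using F(1) M by auto
  ultimately show thesis using that by metis
qed

section \<open>Functions of compact support\<close>

text \<open>A locally compact Hausdorff space is completely regular. Separating \<open>x\<close>
  from the complement of \<open>U \<inter> V\<close>, where \<open>U\<close> lies in the compact
  \<open>K\<close>, also bounds the support.\<close>

lemma bump_function:
  fixes V :: "'a::t2_space set"
  assumes lc: "locally_compact_space (euclidean :: 'a topology)" and "open V" "x \<in> V"
  obtains \<phi> where "\<phi> \<in> Cc" "\<phi> x = 1" "\<And>y. y \<notin> V \<Longrightarrow> \<phi> y = 0"
proof -
  have haus: "Hausdorff_space (euclidean :: 'a topology)"
    unfolding Hausdorff_space_def using hausdorff by (auto simp: disjnt_def)
  obtain U K where UK: "open U" "compact K" "x \<in> U" "U \<subseteq> K"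
    using lc unfolding locally_compact_space_def by simp blast
  have "completely_regular_space (euclidean :: 'a topology)"
    using locally_compact_regular_imp_completely_regular_space[OF lc] haus by blast
  moreover have "closedin euclidean (- (U \<inter> V))" "x \<in> topspace euclidean - (- (U \<inter> V))"
    using UK assms by (auto simp: closed_def)
  ultimately obtain f :: "'a \<Rightarrow> real" where f: "continuous_map euclidean euclideanreal f" "f x = 0"
      "f ` (- (U \<inter> V)) \<subseteq> {1}"
    unfolding completely_regular_space_alt by meson
  define \<phi> where "\<phi> y = complex_of_real (1 - f y)" for y
  have "continuous_on UNIV \<phi>"
    unfolding \<phi>_def using f(1) by (intro continuous_intros) auto
  moreover have out: "\<phi> y = 0" if "y \<notin> U \<inter> V" for y
    using f(3) that unfolding \<phi>_def by auto
  moreover have "closure {x. \<phi> x \<noteq> 0} \<subseteq> K"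
    using out UK by (intro closure_minimal compact_imp_closed) auto
  then have "compact (closure {x. \<phi> x \<noteq> 0})"
    using compact_Int_closed[OF UK(2) closed_closure] by (metis Int_absorb1)
  ultimately show thesis
    using that[of \<phi>] f(2) by (auto simp: Cc_def support_def \<phi>_def)
qed

lemma Cc_translate:
  fixes \<phi> :: "'a::topological_ab_group_add \<Rightarrow> complex"
  assumes "\<phi> \<in> Cc" shows "(\<lambda>s. \<phi> (s + t)) \<in> Cc"
proof -
  have cont: "continuous_on UNIV \<phi>" and cpt: "compact (closure {x. \<phi> x \<noteq> 0})"
    using assms by (auto simp: Cc_def support_def)
  have "compact ((\<lambda>x. x - t) ` closure {x. \<phi> x \<noteq> 0})"
    by (intro compact_continuous_image continuous_intros cpt)
  moreover have "(\<lambda>x. x - t) ` closure {x. \<phi> x \<noteq> 0} = (\<lambda>x. x + t) -` closure {x. \<phi> x \<noteq> 0}"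
    by (force simp: image_iff)
  moreover have "closed ((\<lambda>x. x + t) -` closure {x. \<phi> x \<noteq> 0})"
    by (intro closed_vimage continuous_intros closed_closure)
  then have "closure {x. \<phi> (x + t) \<noteq> 0} \<subseteq> (\<lambda>x. x + t) -` closure {x. \<phi> x \<noteq> 0}"
    by (intro closure_minimal) (use closure_subset[of "{x. \<phi> x \<noteq> 0}"] in auto)
  ultimately have "compact (closure {x. \<phi> (x + t) \<noteq> 0})"
    using compact_Int_closed[OF _ closed_closure] by (metis Int_absorb1)
  moreover have "continuous_on UNIV (\<lambda>s. \<phi> (s + t))"
    by (intro continuous_intros continuous_on_compose2[OF cont]) auto
  ultimately show ?thesis by (simp add: Cc_def support_def)
qed

lemma translate_translate: "translate s (translate t \<mu>) = translate (s + t) \<mu>"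
  unfolding translate_def
  by (rule restrict_ext) (simp add: Cc_translate add.assoc add.commute[of s])

section \<open>Model sets\<close>

text \<open>Injectivity of the first projection makes the definite description in
  \<open>star\<close> well defined; afterwards lattice pairs replace it throughout.\<close>

lemma mem_model_set_iff:
  assumes "inj_on fst Lt"
  shows "x \<in> model_set Lt W \<longleftrightarrow> (\<exists>k\<in>W. (x, k) \<in> Lt)"
proof -
  have "star Lt x = k" if "(x, k) \<in> Lt" for k
    unfolding star_def using that inj_onD[OF assms] by (intro the_equality) force+
  then show ?thesis unfolding model_set_def by force
qed

lemma translate_model_comb:
  fixes \<phi> :: "'g::topological_ab_group_add \<Rightarrow> complex"
  assumes "\<phi> \<in> Cc"
  shows "translate t (model_comb Lt W) \<phi> = (\<Sum>\<^sub>\<infinity>x\<in>model_set Lt W. \<phi> (x + t))"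
  using assms Cc_translate[OF assms, of t] by (simp add: translate_def model_comb_def dirac_def)

lemma translate_0_model_comb: "translate 0 (model_comb Lt W) = model_comb Lt W"
  by (auto simp: translate_def model_comb_def intro!: ext)

lemma infsum_eq_single:
  fixes f :: "'a \<Rightarrow> 'b::{comm_monoid_add, t2_space}"
  assumes "a \<in> A" "\<And>x. x \<in> A \<Longrightarrow> x \<noteq> a \<Longrightarrow> f x = 0"
  shows "infsum f A = f a"
proof -
  have "infsum f A = infsum f {a}"
    by (rule infsum_cong_neutral) (use assms in auto)
  then show ?thesis by simp
qed

text \<open>Uniform discreteness of model sets rests on this. Finitely many translates of
  \<open>U\<close> cover \<open>C \<times> K\<close>, and each holds at most one lattice point, as
  the difference of two is a lattice point of \<open>O0\<close>, hence zero. So only finitely many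
  first coordinates have to be cut out of \<open>B\<close>.\<close>

lemma lattice_strip_isolated:
  fixes Lt :: "('g::{topological_ab_group_add,t2_space} \<times> 'h::topological_ab_group_add) set"
  assumes L: "is_subgroup Lt" and "discrete Lt"
    and lc: "locally_compact_space (euclidean :: 'g topology)" and "compact K"
  obtains V where "open V" "0 \<in> V" "\<And>t k. (t, k) \<in> Lt \<Longrightarrow> k \<in> K \<Longrightarrow> t \<in> V \<Longrightarrow> t = 0"
proof -
  obtain O0 where O0: "open O0" "O0 \<inter> Lt = {0}"
    using assms(2) is_subgroup_closed(1)[OF L] unfolding discrete_def isolated_in_def by meson
  then have "0 \<in> O0" by blast
  then obtain U where U: "open U" "0 \<in> U" "\<And>x y. x \<in> U \<Longrightarrow> y \<in> U \<Longrightarrow> x - y \<in> O0"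
    using nhd_zero_add_diff[OF O0(1)] by metis
  obtain B C where BC: "open B" "compact C" "(0::'g) \<in> B" "B \<subseteq> C"
    using lc unfolding locally_compact_space_def by simp blast
  have "compact (C \<times> K)" using BC assms by (simp add: compact_Times)
  moreover have "open {y. - p + y \<in> U}" for p
    by (intro open_translation_vimage U)
  moreover have "p \<in> {y. - p + y \<in> U}" for p
    using U(2) by simp
  then have "C \<times> K \<subseteq> (\<Union>p\<in>UNIV. {y. - p + y \<in> U})"
    by blast
  ultimately obtain F where F: "finite F" "C \<times> K \<subseteq> (\<Union>p\<in>F. {y. - p + y \<in> U})"
    using compactE_image[of "C \<times> K" UNIV "\<lambda>p. {y. - p + y \<in> U}"] by metis
  have "finite (Lt \<inter> {y. - p + y \<in> U})" for p
  proof -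
    have "x = y" if "x \<in> Lt" "y \<in> Lt" "- p + x \<in> U" "- p + y \<in> U" for x y
    proof -
      have "x - y \<in> O0" using U(3)[OF that(3,4)] by simp
      then have "x - y \<in> O0 \<inter> Lt" using is_subgroup_closed(2)[OF L] that by blast
      then show ?thesis using O0(2) by simp
    qed
    then have "\<exists>x. Lt \<inter> {y. - p + y \<in> U} \<subseteq> {x}" by blast
    then show ?thesis using finite_subset by blast
  qed
  then have "finite (\<Union>p\<in>F. Lt \<inter> {y. - p + y \<in> U})" using F(1) by blast
  moreover have "Lt \<inter> C \<times> K \<subseteq> (\<Union>p\<in>F. Lt \<inter> {y. - p + y \<in> U})" using F(2) by blast
  ultimately have fin: "finite (Lt \<inter> C \<times> K)" using finite_subset by blast
  define V where "V = B - (fst ` (Lt \<inter> C \<times> K) - {0})"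
  have "open V" unfolding V_def using fin BC by (intro open_Diff finite_imp_closed) auto
  moreover have "t = 0" if "(t, k) \<in> Lt" "k \<in> K" "t \<in> V" for t k
    using that BC(4) unfolding V_def by force
  ultimately show thesis using that[of V] BC(3) unfolding V_def by blast
qed

section \<open>The stabiliser of the model comb\<close>

lemma stabiliser_model_comb_subgroup: "is_subgroup {t. translate t (model_comb Lt W) = model_comb Lt W}"
  unfolding is_subgroup_def
proof (intro conjI ballI)
  fix x y
  assume x: "x \<in> {t. translate t (model_comb Lt W) = model_comb Lt W}"
    and y: "y \<in> {t. translate t (model_comb Lt W) = model_comb Lt W}"
  have "translate (x - y) (model_comb Lt W) = translate (x - y) (translate y (model_comb Lt W))"
    using y by simp
  also have "\<dots> = model_comb Lt W"
    using x by (simp add: translate_translate)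
  finally show "x - y \<in> {t. translate t (model_comb Lt W) = model_comb Lt W}" by simp
qed (simp add: translate_0_model_comb)

text \<open>Adding \<open>(t, n)\<close> shifts the second coordinate by \<open>n\<close>, so
  translation by \<open>t\<close> permutes the model set and the sum is only reindexed.\<close>

lemma stabiliser_model_combI:
  assumes L: "is_subgroup Lt" and inj: "inj_on fst Lt" and tn: "(t, n) \<in> Lt"
    and W: "\<And>w. w \<in> W \<Longrightarrow> w + n \<in> W" "\<And>w. w \<in> W \<Longrightarrow> w - n \<in> W"
  shows "translate t (model_comb Lt W) = model_comb Lt W"
proof
  fix \<phi>
  have plus: "x + t \<in> model_set Lt W" if "x \<in> model_set Lt W" for x
    using that W(1) is_subgroup_closed(3)[OF L _ tn] unfolding mem_model_set_iff[OF inj] by fastforce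
  have minus: "x - t \<in> model_set Lt W" if "x \<in> model_set Lt W" for x
    using that W(2) is_subgroup_closed(2)[OF L _ tn] unfolding mem_model_set_iff[OF inj] by fastforce
  have bij: "bij_betw (\<lambda>x. x + t) (model_set Lt W) (model_set Lt W)"
    by (rule bij_betw_byWitness[where f' = "\<lambda>x. x - t"]) (use plus minus in auto)
  show "translate t (model_comb Lt W) \<phi> = model_comb Lt W \<phi>"
  proof (cases "\<phi> \<in> Cc")
    case True
    then show ?thesis
      using infsum_reindex_bij_betw[OF bij, of \<phi>]
      by (simp add: translate_model_comb) (simp add: model_comb_def dirac_def)
  qed (simp add: translate_def model_comb_def)
qed

lemma discrete_subgroupI:
  fixes P :: "'a::topological_ab_group_add set"
  assumes P: "is_subgroup P" and V: "open V" "0 \<in> V" "P \<inter> V \<subseteq> {0}"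
  shows "discrete P"
proof (rule discreteI)
  fix p assume p: "p \<in> P"
  have "{y. - p + y \<in> V} \<inter> P = {p}"
  proof (intro equalityI subsetI)
    fix y assume "y \<in> {y. - p + y \<in> V} \<inter> P"
    then have "y - p \<in> P \<inter> V" using is_subgroup_closed(2)[OF P _ p] by simp
    then show "y \<in> {p}" using V(3) by auto
  qed (use p V in auto)
  then show "p isolated_in P"
    unfolding isolated_in_def using p open_translation_vimage[OF V(1)] by blast
qed

text \<open>A small nonzero \<open>t\<close> in the stabiliser is refuted by a bump at a single
  point \<open>x0\<close>, chosen to vanish at \<open>x0 + t\<close>: the comb gives
  \<open>1\<close> on it and the translated comb gives \<open>0\<close>.\<close>

lemma stabiliser_model_comb_discrete:
  fixes Lt :: "('g::{topological_ab_group_add,t2_space} \<times> 'h::{topological_ab_group_add,t2_space}) set"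
  assumes L: "is_subgroup Lt" "discrete Lt" and inj: "inj_on fst Lt"
    and lc: "locally_compact_space (euclidean :: 'g topology)"
    and "compact W" and x0: "x0 \<in> model_set Lt W"
  shows "discrete {t. translate t (model_comb Lt W) = model_comb Lt W}"
proof -
  obtain w0 where w0: "(x0, w0) \<in> Lt" "w0 \<in> W" using x0 mem_model_set_iff[OF inj] by blast
  \<comment> \<open>Separation is needed only from the fixed point \<open>x0\<close>, so second
    coordinates range over \<open>W - w0\<close>.\<close>
  have "compact ((\<lambda>w. w - w0) ` W)"
    by (intro compact_continuous_image continuous_intros assms)
  then obtain V where V: "open V" "0 \<in> V"
      "\<And>t k. (t, k) \<in> Lt \<Longrightarrow> k \<in> (\<lambda>w. w - w0) ` W \<Longrightarrow> t \<in> V \<Longrightarrow> t = 0"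
    using lattice_strip_isolated[OF L lc] by metis
  have sep: "x = x0" if x: "x \<in> model_set Lt W" "x - x0 \<in> V" for x
  proof -
    obtain w where w: "(x, w) \<in> Lt" "w \<in> W"
      using x(1) unfolding mem_model_set_iff[OF inj] by blast
    have "(x - x0, w - w0) \<in> Lt"
      using is_subgroup_closed(2)[OF L(1) w(1) w0(1)] by simp
    then have "x - x0 = 0" by (rule V(3)) (use x(2) w(2) in simp_all)
    then show ?thesis by simp
  qed
  obtain M where M: "open M" "0 \<in> M" "M \<subseteq> V" "\<And>x y. x \<in> M \<Longrightarrow> y \<in> M \<Longrightarrow> x - y \<in> V"
    using nhd_zero_add_diff[OF V(1,2)] by metis
  have "t = 0" if t: "translate t (model_comb Lt W) = model_comb Lt W" "t \<in> M" for t
  proof (rule ccontr)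
    assume "t \<noteq> 0"
    have "open {y. - x0 + y \<in> M - {t}}"
      by (intro open_translation_vimage open_Diff M closed_singleton)
    then obtain \<phi> where \<phi>: "\<phi> \<in> Cc" "\<phi> x0 = 1" "\<And>y. - x0 + y \<notin> M - {t} \<Longrightarrow> \<phi> y = 0"
      using bump_function[OF lc, of "{y. - x0 + y \<in> M - {t}}" x0] M(2) \<open>t \<noteq> 0\<close> by auto
    have "(\<Sum>\<^sub>\<infinity>x\<in>model_set Lt W. \<phi> (x + 0)) = \<phi> (x0 + 0)"
    proof (rule infsum_eq_single[OF x0])
      fix x assume "x \<in> model_set Lt W" "x \<noteq> x0"
      then have "x - x0 \<notin> M" using sep M(3) by blast
      then show "\<phi> (x + 0) = 0" using \<phi>(3)[of x] by simp
    qed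
    then have "translate 0 (model_comb Lt W) \<phi> = 1"
      unfolding translate_model_comb[OF \<phi>(1)] using \<phi>(2) by simp
    moreover have "translate t (model_comb Lt W) \<phi> = 0"
      unfolding translate_model_comb[OF \<phi>(1)]
    proof (rule infsum_0)
      fix x assume x: "x \<in> model_set Lt W"
      show "\<phi> (x + t) = 0"
      proof (cases "x = x0")
        case False
        have "x - x0 + t - t \<in> V" if "x - x0 + t \<in> M" by (rule M(4)[OF that t(2)])
        then have "x - x0 + t \<notin> M" using sep[OF x] False by auto
        then show ?thesis by (intro \<phi>(3)) (simp add: algebra_simps)
      qed (use \<phi>(3)[of "x + t"] in simp)
    qed
    ultimately show False using t(1) by (simp add: translate_0_model_comb)
  qed
  then show ?thesis
    by (intro discrete_subgroupI[OF stabiliser_model_comb_subgroup M(1,2)]) auto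
qed

section \<open>Density and cocompactness\<close>

lemma dense_mem_open:
  assumes "closure D = UNIV" "open A" "x \<in> A"
  obtains d where "d \<in> D" "d \<in> A"
  using assms open_Int_closure_eq_empty[of A D] by auto

lemma cocompact_projection:
  fixes Lt :: "('g::topological_ab_group_add \<times> 'h::topological_ab_group_add) set"
  assumes L: "is_subgroup Lt" and cpt: "compact_space (quotient_topology Lt)"
    and dense: "closure (snd ` Lt) = UNIV"
    and S: "is_subgroup S" "open S" and P: "is_subgroup P"
    and sub: "\<And>t n. (t, n) \<in> Lt \<Longrightarrow> n \<in> S \<Longrightarrow> t \<in> P"
  shows "compact_space (quotient_topology P)"
proof -
  txt \<open>
    The torus is mapped onto the quotient by \<open>P\<close>: given \<open>(s, k)\<close>, choose \<open>(t, n) \<in> Lt\<close> with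
    \<open>n + k \<in> S\<close> and send \<open>[s, k]\<close> to the class of \<open>s + t\<close>.
  \<close>
  have "\<exists>l. l \<in> Lt \<and> snd l + k \<in> S" for k
  proof -
    have "open {y. k + y \<in> S}" "- k \<in> {y. k + y \<in> S}"
      using open_translation_vimage[OF S(2)] is_subgroup_closed(1)[OF S(1)] by auto
    then obtain d where "d \<in> snd ` Lt" "d \<in> {y. k + y \<in> S}"
      using dense_mem_open[OF dense] by metis
    then obtain p where "p \<in> Lt" "k + snd p \<in> S" by blast
    then show ?thesis by (intro exI[of _ p]) (simp add: add.commute[of _ k])
  qed
  then obtain l where l: "\<And>k. l k \<in> Lt" "\<And>k. snd (l k) + k \<in> S" by metis
  define g where "g p = coset P (fst p + fst (l (snd p)))" for p
  \<comment> \<open>The class does not depend on the lattice point chosen: two choices differ by a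
    lattice element over \<open>S\<close>, whose first coordinate is in \<open>P\<close> by
    \<open>sub\<close>.\<close>
  have g_eq: "g (s, k) = coset P (s + t)" if "(t, n) \<in> Lt" "n + k \<in> S" for s k t n
  proof -
    have "(fst (l k) - t, snd (l k) - n) \<in> Lt"
      using is_subgroup_closed(2)[OF L l(1)[of k] that(1)] by (simp add: minus_prod_def)
    moreover have "snd (l k) - n \<in> S"
      using is_subgroup_closed(2)[OF S(1) l(2)[of k] that(2)] by simp
    ultimately have "fst (l k) - t \<in> P" using sub by blast
    then show ?thesis unfolding g_def by (simp add: coset_eq_iff[OF P])
  qed
  have g_per: "g p = g q" if "p - q \<in> Lt" for p q
  proof -
    obtain s k s' k' where pq: "p = (s, k)" "q = (s', k')" by (metis surj_pair)
    \<comment> \<open>\<open>(t, n)\<close> is \<open>l k + (p - q)\<close>, an admissible choice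
      for \<open>k'\<close> that compensates the change of representative.\<close>
    define t where "t = fst (l k) + (s - s')"
    define n where "n = snd (l k) + (k - k')"
    have "l k + (p - q) \<in> Lt" by (rule is_subgroup_closed(3)[OF L l(1) that])
    then have "(t, n) \<in> Lt"
      by (simp add: pq t_def n_def plus_prod_def)
    moreover have "n + k' \<in> S" using l(2)[of k] by (simp add: n_def)
    ultimately have "g (s', k') = coset P (s' + t)" by (rule g_eq)
    then show ?thesis unfolding pq by (simp add: g_def t_def algebra_simps)
  qed
  define f where "f \<xi> = g (SOME p. coset Lt p = \<xi>)" for \<xi>
  have f_coset: "f (coset Lt p) = g p" for p
  proof -
    have "coset Lt (SOME q. coset Lt q = coset Lt p) = coset Lt p"
      by (rule someI[of "\<lambda>q. coset Lt q = coset Lt p"]) simp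
    then show ?thesis unfolding f_def by (intro g_per) (simp add: coset_eq_iff[OF L])
  qed
  have cosetcont: "continuous_map euclidean (quotient_topology P) (coset P)"
    using quotient_map_coset quotient_imp_continuous_map by blast
  have "continuous_map euclidean (quotient_topology P) g"
    unfolding continuous_map_def
  proof (intro conjI allI impI)
    show "g \<in> topspace euclidean \<rightarrow> topspace (quotient_topology P)"
      by (auto simp: g_def topspace_quotient_topology)
  next
    fix U assume U: "openin (quotient_topology P) U"
    have "open {p. g p \<in> U}"
    proof (subst open_subopen, intro ballI)
      fix p assume p: "p \<in> {p. g p \<in> U}"
      obtain s k where sk: "p = (s, k)" by (metis surj_pair)
      \<comment> \<open>Openness of \<open>S\<close> makes the single lattice element
        \<open>l k\<close> admissible for all second coordinates near \<open>k\<close>, so over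
        \<open>B\<close> the map \<open>g\<close> is a fixed translation followed by
        \<open>coset P\<close>.\<close>
      define A where "A = {s'. fst (l k) + s' \<in> coset P -` U}"
      define B where "B = {k'. snd (l k) + k' \<in> S}"
      have "open (coset P -` U)" using U by (simp add: openin_quotient_topology)
      then have "open (A \<times> B)" unfolding A_def B_def
        by (intro open_Times open_translation_vimage S)
      moreover have g_B: "g (s', k') = coset P (fst (l k) + s')" if "k' \<in> B" for s' k'
        using g_eq[of "fst (l k)" "snd (l k)" k' s'] l(1) that by (simp add: B_def add.commute)
      have "k \<in> B" using l(2) by (simp add: B_def)
      then have "p \<in> A \<times> B" using p g_B by (simp add: sk A_def)
      moreover have "A \<times> B \<subseteq> {p. g p \<in> U}" using g_B by (auto simp: A_def)
      ultimately show "\<exists>T. open T \<and> p \<in> T \<and> T \<subseteq> {p. g p \<in> U}" by blast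
    qed
    then show "openin euclidean {x \<in> topspace euclidean. g x \<in> U}" by simp
  qed
  then have "continuous_map euclidean (quotient_topology P) (f \<circ> coset Lt)"
    by (simp add: f_coset o_def)
  then have cont: "continuous_map (quotient_topology Lt) (quotient_topology P) f"
    by (rule continuous_compose_quotient_map[OF quotient_map_coset])
  have "coset P s \<in> f ` topspace (quotient_topology Lt)" for s
  proof -
    have "f (coset Lt (s, 0)) = coset P (s + 0)"
      unfolding f_coset using is_subgroup_closed(1)[OF L] is_subgroup_closed(1)[OF S(1)]
      by (intro g_eq[of 0 0]) (simp_all add: zero_prod_def)
    then have "coset P s = f (coset Lt (s, 0))" by simp
    then show ?thesis by (rule image_eqI) (simp add: topspace_quotient_topology)
  qed
  then have "topspace (quotient_topology P) \<subseteq> f ` topspace (quotient_topology Lt)"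
    unfolding topspace_quotient_topology by blast
  then have "f ` topspace (quotient_topology Lt) = topspace (quotient_topology P)"
    using continuous_map_image_subset_topspace[OF cont] by blast
  moreover have "compactin (quotient_topology P) (f ` topspace (quotient_topology Lt))"
    using cpt unfolding compact_space_def by (rule image_compactin[OF _ cont])
  ultimately show ?thesis
    by (simp add: compact_space_def)
qed

section \<open>Torus factors\<close>

text \<open>Nonemptiness of the orbit closure puts at least one translate of \<mu> into it; \<psi>
  attains that translate, and equivariance carries the preimage back to one of \<mu> itself.\<close>

lemma factor_orbit_closure_base_point:
  fixes \<mu> :: "'g::topological_ab_group_add functional"
  assumes cont: "continuous_map X (orbit_closure_topology \<mu>) \<psi>"
    and surj: "\<psi> ` topspace X = topspace (orbit_closure_topology \<mu>)"
    and equi: "\<And>t \<xi>. \<xi> \<in> topspace X \<Longrightarrow> \<psi> (\<beta> t \<xi>) = translate t (\<psi> \<xi>)"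
    and inv: "\<And>t \<xi>. \<xi> \<in> topspace X \<Longrightarrow> \<beta> t \<xi> \<in> topspace X"
    and ne: "topspace X \<noteq> {}" and id: "translate 0 \<mu> = \<mu>"
  obtains \<xi> where "\<xi> \<in> topspace X" "\<psi> \<xi> = \<mu>"
proof -
  \<comment> \<open>If no translate of \<open>\<mu>\<close> were translation bounded, the vague closure would be empty.\<close>
  have "orbit_closure \<mu> \<noteq> {}"
    using ne surj unfolding orbit_closure_topology_def by auto
  then have "range (\<lambda>t. translate t \<mu>) \<inter> topspace vague_topology \<noteq> {}"
    unfolding orbit_closure_def closure_of_eq_empty_gen disjnt_def by blast
  then obtain t where t: "translate t \<mu> \<in> topspace vague_topology" by auto
  then have "translate t \<mu> \<in> topspace vague_topology \<inter> range (\<lambda>t. translate t \<mu>)" by simp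
  then have "translate t \<mu> \<in> orbit_closure \<mu>"
    unfolding orbit_closure_def by (rule subsetD[OF closure_of_subset_Int])
  then have "translate t \<mu> \<in> \<psi> ` topspace X"
    using t unfolding surj orbit_closure_topology_def topspace_subtopology by (rule IntI[rotated])
  then obtain \<xi> where \<xi>: "\<xi> \<in> topspace X" "\<psi> \<xi> = translate t \<mu>" by (metis imageE)
  have "\<psi> (\<beta> (- t) \<xi>) = translate (- t) (translate t \<mu>)"
    using equi[OF \<xi>(1)] \<xi>(2) by metis
  also have "\<dots> = \<mu>"
    by (simp add: translate_translate id)
  finally show thesis using that inv[OF \<xi>(1)] by blast
qed

lemma continuous_map_orbit_closure_eval:
  assumes "\<phi> \<in> Cc"
  shows "continuous_map (orbit_closure_topology \<mu>) euclidean (\<lambda>\<nu>. \<nu> \<phi>)"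
  unfolding orbit_closure_topology_def vague_topology_def
  by (intro continuous_map_from_subtopology continuous_map_product_projection assms)

text \<open>Testing the factor map on a bump turns it into a continuous function \<open>f\<close>
  periodic under \<open>Lt\<close>, whose values along the orbit of the base point are sums of
  \<phi> over translates of the model set. A missing point \<open>x0 - t\<close> would make two of
  these values \<open>1\<close> and \<open>0\<close>, although their arguments differ only by
  \<open>(0, n)\<close> modulo \<open>Lt\<close>.\<close>

lemma translate_model_set_subset:
  fixes Lt :: "('g::{topological_ab_group_add,t2_space} \<times> 'h::{topological_ab_group_add,t2_space}) set"
  assumes L: "is_lattice Lt" and inj: "inj_on fst Lt"
    and lcG: "locally_compact_space (euclidean :: 'g topology)"
    and lcH: "locally_compact_space (euclidean :: 'h topology)"
    and W: "compact W"
    and cont: "continuous_map (quotient_topology Lt) (orbit_closure_topology (model_comb Lt W)) \<psi>"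
    and equi: "\<And>t \<xi>. \<xi> \<in> topspace (quotient_topology Lt) \<Longrightarrow>
      \<psi> (torus_action t \<xi>) = translate t (\<psi> \<xi>)"
    and base: "\<psi> (coset Lt (a, b)) = model_comb Lt W"
  obtains N where "open N" "0 \<in> N"
    "\<And>t n x. (t, n) \<in> Lt \<Longrightarrow> n \<in> N \<Longrightarrow> x \<in> model_set Lt W \<Longrightarrow> x - t \<in> model_set Lt W"
proof -
  have sub: "is_subgroup Lt" and disc: "discrete Lt" and cpt: "compact_space (quotient_topology Lt)"
    using L by (auto simp: is_lattice_def)
  obtain B C where BC: "open B" "compact C" "(0::'h) \<in> B" "B \<subseteq> C"
    using lcH unfolding locally_compact_space_def by simp blast
  \<comment> \<open>\<open>K\<close> is \<open>W - W + C\<close>, so it contains the second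
    coordinate belonging to every \<open>x - x0 + t\<close> with \<open>n\<close> in
    \<open>B\<close>.\<close>
  define K where "K = (\<lambda>(w, w', c). w - w' + c) ` (W \<times> W \<times> C)"
  have "compact K" unfolding K_def
    by (intro compact_continuous_image compact_Times W BC)
      (auto simp: case_prod_unfold intro!: continuous_intros)
  then obtain V where V: "open V" "0 \<in> V" "\<And>t k. (t, k) \<in> Lt \<Longrightarrow> k \<in> K \<Longrightarrow> t \<in> V \<Longrightarrow> t = 0"
    using lattice_strip_isolated[OF sub disc lcG] by metis
  have sep: "x = x0 - t" if x: "x \<in> model_set Lt W" "x0 \<in> model_set Lt W"
    and tn: "(t, n) \<in> Lt" "n \<in> B" and diff: "x - x0 + t \<in> V" for x x0 t n
  proof -
    obtain w w0 where w: "(x, w) \<in> Lt" "w \<in> W" "(x0, w0) \<in> Lt" "w0 \<in> W"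
      using x unfolding mem_model_set_iff[OF inj] by blast
    have "(x, w) - (x0, w0) + (t, n) \<in> Lt"
      by (intro is_subgroup_closed(2,3)[OF sub] w tn)
    then have "(x - x0 + t, w - w0 + n) \<in> Lt" by simp
    moreover have "w - w0 + n \<in> K"
      unfolding K_def using w tn BC by (intro image_eqI[of _ _ "(w, w0, n)"]) auto
    ultimately have "x - x0 + t = 0" using V(3) diff by blast
    then show ?thesis by (simp add: eq_diff_eq add_eq_0_iff2 algebra_simps)
  qed
  obtain \<phi> where \<phi>: "\<phi> \<in> Cc" "\<phi> 0 = 1" "\<And>y. y \<notin> V \<Longrightarrow> \<phi> y = 0"
    using bump_function[OF lcG V(1,2)] by metis
  define f where "f p = \<psi> (coset Lt p) \<phi>" for p
  have "continuous_map euclidean (quotient_topology Lt) (coset Lt)"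
    using quotient_map_coset quotient_imp_continuous_map by blast
  from continuous_map_compose[OF continuous_map_compose[OF this cont]
      continuous_map_orbit_closure_eval[OF \<phi>(1)]]
  have "continuous_on UNIV f" by (simp add: f_def o_def)
  moreover have "f (p + l) = f p" if "l \<in> Lt" for p l
  proof -
    have "coset Lt (p + l) = coset Lt p" using that by (simp add: coset_eq_iff[OF sub])
    then show ?thesis by (simp add: f_def)
  qed
  ultimately obtain N where N: "open N" "0 \<in> N" "\<And>p n. n \<in> N \<Longrightarrow> dist (f (p + n)) (f p) < 1"
    using periodic_continuous_uniformly[OF sub cpt, of f 1] zero_less_one by metis
  \<comment> \<open>\<open>B\<close> makes \<open>sep\<close> available; the slice of
    \<open>N\<close> gives uniform continuity in the direction of \<open>'h\<close>.\<close>
  define N' where "N' = B \<inter> Pair 0 -` N"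
  have "open N'" unfolding N'_def
    by (intro open_Int BC open_vimage N continuous_intros)
  moreover have "0 \<in> N'" using N(2) BC by (simp add: N'_def zero_prod_def)
  moreover have "x0 - t \<in> model_set Lt W"
    if tn: "(t, n) \<in> Lt" and n: "n \<in> N'" and x0: "x0 \<in> model_set Lt W" for t n x0
  proof (rule ccontr)
    assume no: "x0 - t \<notin> model_set Lt W"
    have f_orbit: "f (a - s, b) = (\<Sum>\<^sub>\<infinity>x\<in>model_set Lt W. \<phi> (x + s))" for s
    proof -
      have "coset Lt (a - s, b) = torus_action s (coset Lt (a, b))" by (simp add: torus_action_coset)
      then have "\<psi> (coset Lt (a - s, b)) = translate s (model_comb Lt W)"
        using equi[of "coset Lt (a, b)" s] base by (simp add: topspace_quotient_topology)
      then show ?thesis by (simp add: f_def translate_model_comb[OF \<phi>(1)])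
    qed
    \<comment> \<open>Taking \<open>s = - x0\<close> centres the bump on \<open>x0\<close>;
      \<open>sep\<close> with the zero lattice element excludes all other terms.\<close>
    have "f (a - (- x0), b) = \<phi> (x0 + (- x0))"
      unfolding f_orbit
    proof (rule infsum_eq_single[OF x0])
      fix x assume "x \<in> model_set Lt W" "x \<noteq> x0"
      moreover have "(0, 0) \<in> Lt" using is_subgroup_closed(1)[OF sub] by (simp add: zero_prod_def)
      ultimately have "x - x0 + 0 \<notin> V" using sep[OF _ x0 _ BC(3)] by fastforce
      then show "\<phi> (x + - x0) = 0" using \<phi>(3) by simp
    qed
    then have one: "f (a - (- x0), b) = 1" using \<phi>(2) by simp
    have "f (a - (t - x0), b) = 0"
      unfolding f_orbit
    proof (rule infsum_0)
      fix x assume x: "x \<in> model_set Lt W"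
      have "x \<noteq> x0 - t" using x no by auto
      then have "x - x0 + t \<notin> V" using sep[OF x x0 tn] n by (auto simp: N'_def)
      then show "\<phi> (x + (t - x0)) = 0" using \<phi>(3) by (simp add: algebra_simps)
    qed
    \<comment> \<open>The two arguments differ by \<open>(t, n)\<close>, hence agree modulo
      \<open>Lt\<close>.\<close>
    moreover have "f (a - (t - x0), b) = f ((a - (- x0), b) + (0, n))"
    proof -
      have "coset Lt (a - (t - x0), b) = coset Lt ((a - (- x0), b) + (0, n))"
        using is_subgroup_closed(4)[OF sub tn] by (simp add: coset_eq_iff[OF sub] algebra_simps)
      then show ?thesis by (simp add: f_def)
    qed
    moreover have "dist (f ((a - (- x0), b) + (0, n))) (f (a - (- x0), b)) < 1"
      by (rule N(3)) (use n in \<open>simp add: N'_def\<close>)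
    ultimately show False using one by simp
  qed
  ultimately show thesis using that by blast
qed

theorem corollary13p1:
  fixes Lt :: "('g::{topological_ab_group_add,t2_space} \<times> 'h::{topological_ab_group_add,t2_space}) set"
    and W :: "'h set"
    and m :: "'h measure"
  assumes "cut_and_project_scheme Lt"
    and "W \<noteq> {}"
    and "compact W"
    and "W = closure (interior W)"
    and "is_haar_measure m"
    and "emeasure m (frontier W) = 0"
    and "\<not> crystallographic (model_comb Lt W)"
  shows "\<not> is_factor_of (orbit_closure_topology (model_comb Lt W)) translate
                        (quotient_topology Lt) torus_action"
proof
  assume factor: "is_factor_of (orbit_closure_topology (model_comb Lt W)) translate
                        (quotient_topology Lt) torus_action"
  have lat: "is_lattice Lt" and inj: "inj_on fst Lt" and dense: "closure (snd ` Lt) = UNIV"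
    and lcG: "locally_compact_space (euclidean :: 'g topology)"
    and lcH: "locally_compact_space (euclidean :: 'h topology)"
    using assms(1) unfolding cut_and_project_scheme_def by auto
  then have sub: "is_subgroup Lt" and disc: "discrete Lt" and cpt: "compact_space (quotient_topology Lt)"
    by (auto simp: is_lattice_def)
  obtain \<psi> where cont: "continuous_map (quotient_topology Lt) (orbit_closure_topology (model_comb Lt W)) \<psi>"
    and surj: "\<psi> ` topspace (quotient_topology Lt) = topspace (orbit_closure_topology (model_comb Lt W))"
    and equi: "\<And>t \<xi>. \<xi> \<in> topspace (quotient_topology Lt) \<Longrightarrow>
      \<psi> (torus_action t \<xi>) = translate t (\<psi> \<xi>)"
    using factor unfolding is_factor_of_def by blast
  have inv: "torus_action t \<xi> \<in> topspace (quotient_topology Lt)"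
    if "\<xi> \<in> topspace (quotient_topology Lt)" for t \<xi>
    using that by (auto simp: topspace_quotient_topology torus_action_coset)
  have ne: "topspace (quotient_topology Lt) \<noteq> {}"
    by (simp add: topspace_quotient_topology)
  obtain \<xi> where "\<xi> \<in> topspace (quotient_topology Lt)" "\<psi> \<xi> = model_comb Lt W"
    by (rule factor_orbit_closure_base_point[OF cont surj equi inv ne translate_0_model_comb])
  then obtain a b where "\<psi> (coset Lt (a, b)) = model_comb Lt W"
    by (auto simp: topspace_quotient_topology)
  from translate_model_set_subset[OF lat inj lcG lcH assms(3) cont equi this]
  obtain N where N: "open N" "0 \<in> N"
    "\<And>t n x. (t, n) \<in> Lt \<Longrightarrow> n \<in> N \<Longrightarrow> x \<in> model_set Lt W \<Longrightarrow> x - t \<in> model_set Lt W"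
    by metis
  have "closed W" using assms(3) compact_imp_closed by blast
  \<comment> \<open>Regular closedness transports density: the lattice projections are dense in the
    open set \<open>interior W\<close>, whose closure is \<open>W\<close>.\<close>
  have W_dense: "closure (W \<inter> snd ` Lt) = W"
  proof
    show "closure (W \<inter> snd ` Lt) \<subseteq> W" using \<open>closed W\<close> by (intro closure_minimal) auto
    have "interior W \<subseteq> closure (interior W \<inter> snd ` Lt)"
      using open_Int_closure_subset[OF open_interior, of W "snd ` Lt"] dense by simp
    also have "\<dots> \<subseteq> closure (W \<inter> snd ` Lt)"
      using interior_subset by (intro closure_mono) auto
    finally show "W \<subseteq> closure (W \<inter> snd ` Lt)"
      using assms(4) closure_minimal closed_closure by metis
  qed
  \<comment> \<open>For a fixed lattice shift \<open>n\<close>, membership holds at the lattice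
    projections in \<open>W\<close> and extends to \<open>W\<close> because the preimage of
    \<open>W\<close> is closed.\<close>
  have shift_dense: "w - n \<in> W" if n: "n \<in> N \<inter> snd ` Lt" and w: "w \<in> W" for w n
  proof -
    obtain t where t: "(t, n) \<in> Lt" using n by auto
    have "W \<inter> snd ` Lt \<subseteq> (\<lambda>w. w - n) -` W"
    proof
      fix w assume "w \<in> W \<inter> snd ` Lt"
      then obtain x where x: "(x, w) \<in> Lt" "w \<in> W" by auto
      then have "x - t \<in> model_set Lt W"
        using N(3)[OF t] n mem_model_set_iff[OF inj] by blast
      then obtain k where k: "(x - t, k) \<in> Lt" "k \<in> W"
        using mem_model_set_iff[OF inj] by blast
      \<comment> \<open>Injectivity of \<open>fst\<close> identifies \<open>k\<close> with
        \<open>w - n\<close>.\<close>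
      moreover have "(x - t, w - n) \<in> Lt"
        using is_subgroup_closed(2)[OF sub x(1) t] by simp
      ultimately show "w \<in> (\<lambda>w. w - n) -` W"
        using inj_onD[OF inj] by fastforce
    qed
    moreover have "closed ((\<lambda>w. w - n) -` W)"
      by (intro closed_vimage continuous_intros \<open>closed W\<close>)
    ultimately show ?thesis using W_dense w closure_minimal by (metis subsetD vimageD)
  qed
  \<comment> \<open>A second density argument, now in \<open>n\<close> with \<open>w\<close> fixed,
    covers all of \<open>N\<close>.\<close>
  have shift: "w - n \<in> W" if n: "n \<in> N" and w: "w \<in> W" for w n
  proof -
    have "closed ((\<lambda>n. w - n) -` W)"
      by (intro closed_vimage continuous_intros \<open>closed W\<close>)
    then have "closure (N \<inter> snd ` Lt) \<subseteq> (\<lambda>n. w - n) -` W"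
      using shift_dense[OF _ w] by (intro closure_minimal) auto
    then show ?thesis
      using open_Int_closure_subset[OF N(1), of "snd ` Lt"] dense n by auto
  qed
  \<comment> \<open>Requiring both signs makes \<open>S\<close> a subgroup directly: it is the full
    stabiliser of \<open>W\<close>.\<close>
  define S where "S = {h. \<forall>w\<in>W. w + h \<in> W \<and> w - h \<in> W}"
  have S: "is_subgroup S"
    unfolding is_subgroup_def
  proof (intro conjI ballI)
    fix x y assume xy: "x \<in> S" "y \<in> S"
    have "w + (x - y) \<in> W" "w - (x - y) \<in> W" if "w \<in> W" for w
    proof -
      have "(w + x) - y \<in> W" "(w - x) + y \<in> W"
        using xy that by (simp_all add: S_def)
      then show "w + (x - y) \<in> W" "w - (x - y) \<in> W"
        by (simp_all add: algebra_simps)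
    qed
    then show "x - y \<in> S" by (simp add: S_def)
  qed (simp add: S_def)
  \<comment> \<open>\<open>shift\<close> moves only by \<open>- n\<close>, so a symmetric
    neighbourhood is used to get both signs.\<close>
  obtain M where M: "open M" "0 \<in> M" "M \<subseteq> N" "\<And>h. h \<in> M \<Longrightarrow> - h \<in> M"
    using nhd_zero_add_diff[OF N(1,2)] by metis
  have "M \<subseteq> S"
  proof
    fix h assume h: "h \<in> M"
    have "w + h \<in> W" "w - h \<in> W" if "w \<in> W" for w
      using shift[of "- h" w] shift[of h w] M(3) M(4)[OF h] h that by auto
    then show "h \<in> S" by (simp add: S_def)
  qed
  have "open S"
  proof (subst open_subopen, intro ballI)
    fix h assume h: "h \<in> S"
    have "{y. - h + y \<in> M} \<subseteq> S"
      using is_subgroup_closed(3)[OF S h] \<open>M \<subseteq> S\<close> by force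
    then show "\<exists>T. open T \<and> h \<in> T \<and> T \<subseteq> S"
      using open_translation_vimage[OF M(1), of "- h"] M(2)
      by (intro exI[of _ "{y. - h + y \<in> M}"]) auto
  qed
  have "W \<inter> snd ` Lt \<noteq> {}" using W_dense assms(2) by auto
  then obtain x0 where "x0 \<in> model_set Lt W" using mem_model_set_iff[OF inj] by fastforce
  then have "discrete {t. translate t (model_comb Lt W) = model_comb Lt W}"
    by (rule stabiliser_model_comb_discrete[OF sub disc inj lcG assms(3)])
  \<comment> \<open>Lattice elements over the open subgroup \<open>S\<close> lie in the stabiliser
    by \<open>stabiliser_model_combI\<close>; this is the condition \<open>sub\<close> of
    \<open>cocompact_projection\<close>.\<close>
  moreover have "compact_space (quotient_topology {t. translate t (model_comb Lt W) = model_comb Lt W})"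
    by (rule cocompact_projection[OF sub cpt dense S \<open>open S\<close> stabiliser_model_comb_subgroup])
      (auto simp: S_def intro!: stabiliser_model_combI[OF sub inj])
  ultimately have "crystallographic (model_comb Lt W)"
    unfolding crystallographic_def is_lattice_def using stabiliser_model_comb_subgroup by blast
  then show False using assms(7) by contradiction
qed

end
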